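(* Let $k,\Delta x,\Delta v>0$, let $m$ be a positive odd integer, let $\mathrm{i}$ be the imaginary unit, and let $$S_m=\begin{pmatrix} -\frac{49}{96}-\frac{7m}{8} & \frac{7}{96} & -\frac{7}{32}-\frac{3m}{8} & \frac{1}{32}\\ -\frac{7}{96} & \frac{49}{96}-\frac{7m}{8} & -\frac{1}{32} & \frac{7}{32}-\frac{3m}{8}\\ \frac{77}{96}+\frac{11m}{8} & -\frac{11}{96} & -\frac{21}{32}-\frac{9m}{8} & \frac{3}{32}\\ \frac{11}{96} & -\frac{77}{96}+\frac{11m}{8} & -\frac{3}{32} & \frac{21}{32}-\frac{9m}{8}\end{pmatrix},$$ $$T_m=\begin{pmatrix} -\frac{35}{96}-\frac{5m}{8} & \frac{5}{96} & \frac{35}{32}+\frac{15m}{8} & -\frac{5}{32}\\ -\frac{5}{96} & \frac{35}{96}-\frac{5m}{8} & \frac{5}{32} & -\frac{35}{32}+\frac{15m}{8}\\ \frac{7}{96}+\frac{m}{8} & -\frac{1}{96} & -\frac{7}{32}-\frac{3m}{8} & \frac{1}{32}\\ \frac{1}{96} & -\frac{7}{96}+\frac{m}{8} & -\frac{1}{32} & \frac{7}{32}-\frac{3m}{8}\end{pmatrix}.$$ Then the eigenvalues of the amplification matrix $$G=\frac{\Delta v}{\Delta x}\left(S_m+T_m e^{-\mathrm{i}k\Delta x}\right)$$ are $$\eta_1=(-3m-\sqrt3)\,\lambda_2\frac{\Delta v}{\Delta x},\quad \eta_2=(-3m+\sqrt3)\,\lambda_2\frac{\Delta v}{\Delta x},\quad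 \eta_3=(-3m-\sqrt3)\,\lambda_1\frac{\Delta v}{\Delta x},\quad \eta_4=(-3m+\sqrt3)\,\lambda_1\frac{\Delta v}{\Delta x},$$ where, with $\hat{i}=e^{-\mathrm{i}k\Delta x}-1$, $$\lambda_1=\frac{3+\hat{i}-\sqrt{9+12\hat{i}+\hat{i}^2}}{6},\qquad \lambda_2=\frac{3+\hat{i}+\sqrt{9+12\hat{i}+\hat{i}^2}}{6}.$$
   Context: The same fixed square root is used in $\lambda_1$ and $\lambda_2$. Origin of the matrices: for $f_t+vf_x=0$, periodic in $x$, on a uniform mesh with cell sizes $\Delta x,\Delta v$, cell centers $(x_i,v_j)$, $v_j=(j-\frac{N_v+1}{2})\Delta v$, $N_v$ even, the semi-discrete upwind discontinuous Galerkin scheme with tensor-product polynomials of degree at most $1$ in each of $x$ and $v$ ($\mathbb{Q}^1$) on cells with $v\ge 0$ ($j\ge \frac{N_v}{2}+1$, $m=2j-N_v-1$) reads $$\frac{d f_{ij}}{dt}=\frac{\Delta v}{\Delta x}\left(S_m f_{ij}+T_m f_{i-1,j}\right),$$ where $f_{ij}=(f_{i-1/4,j+1/4},\,f_{i-1/4,j-1/4},\,f_{i+1/4,j+1/4},\,f_{i+1/4,j-1/4})^T$ is the vector of values of the numerical solution at the points $(x_i\pm\Delta x/4,\,v_j\pm\Delta v/4)$ of the cell. The matrix $G$ (called $G_j$ for cell row $j$) is the one governing the Fourier modes $f_{ij}(t)=e^{\mathrm{i}kx_i}F_j(t)$, i.e. $F_j'=G_jF_j$. *)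

theory Defs
  imports
    Complex_Main
    "HOL-Library.Multiset"
    "Jordan_Normal_Form.Spectral_Radius"
begin

definition S_mat :: "int \<Rightarrow> complex mat" where
  "S_mat m = mat_of_rows_list 4
    [[- (49/96) - 7 * of_int m / 8,  7/96,
      - (7/32) - 3 * of_int m / 8,   1/32],
     [- (7/96),                      49/96 - 7 * of_int m / 8,
      - (1/32),                      7/32 - 3 * of_int m / 8],
     [77/96 + 11 * of_int m / 8,     - (11/96),
      - (21/32) - 9 * of_int m / 8,  3/32],
     [11/96,                         - (77/96) + 11 * of_int m / 8,
      - (3/32),                      21/32 - 9 * of_int m / 8]]"

definition T_mat :: "int \<Rightarrow> complex mat" where
  "T_mat m = mat_of_rows_list 4
    [[- (35/96) - 5 * of_int m / 8,  5/96,
      35/32 + 15 * of_int m / 8,     - (5/32)],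
     [- (5/96),                      35/96 - 5 * of_int m / 8,
      5/32,                          - (35/32) + 15 * of_int m / 8],
     [7/96 + of_int m / 8,           - (1/96),
      - (7/32) - 3 * of_int m / 8,   1/32],
     [1/96,                          - (7/96) + of_int m / 8,
      - (1/32),                      7/32 - 3 * of_int m / 8]]"

definition amplification_matrix :: "real \<Rightarrow> real \<Rightarrow> real \<Rightarrow> int \<Rightarrow> complex mat" where
  "amplification_matrix k \<Delta>x \<Delta>v m =
    complex_of_real (\<Delta>v / \<Delta>x) \<cdot>\<^sub>m
      (S_mat m + exp (- \<i> * complex_of_real (k * \<Delta>x)) \<cdot>\<^sub>m T_mat m)"

definition i_hat :: "real \<Rightarrow> real \<Rightarrow> complex" where
  "i_hat k \<Delta>x = exp (- \<i> * complex_of_real (k * \<Delta>x)) - 1"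

(* The argument r is the chosen square root of 9 + 12 z + z^2, where z is i_hat;
   the same r has to be passed to lambda1 and lambda2. *)
definition lambda1 :: "complex \<Rightarrow> complex \<Rightarrow> complex" where
  "lambda1 z r = (3 + z - r) / 6"

definition lambda2 :: "complex \<Rightarrow> complex \<Rightarrow> complex" where
  "lambda2 z r = (3 + z + r) / 6"

definition eta1 :: "complex \<Rightarrow> complex \<Rightarrow> real \<Rightarrow> real \<Rightarrow> int \<Rightarrow> complex" where
  "eta1 z r \<Delta>x \<Delta>v m =
    complex_of_real (- 3 * of_int m - sqrt 3) * lambda2 z r * complex_of_real (\<Delta>v / \<Delta>x)"

definition eta2 :: "complex \<Rightarrow> complex \<Rightarrow> real \<Rightarrow> real \<Rightarrow> int \<Rightarrow> complex" where
  "eta2 z r \<Delta>x \<Delta>v m =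
    complex_of_real (- 3 * of_int m + sqrt 3) * lambda2 z r * complex_of_real (\<Delta>v / \<Delta>x)"

definition eta3 :: "complex \<Rightarrow> complex \<Rightarrow> real \<Rightarrow> real \<Rightarrow> int \<Rightarrow> complex" where
  "eta3 z r \<Delta>x \<Delta>v m =
    complex_of_real (- 3 * of_int m - sqrt 3) * lambda1 z r * complex_of_real (\<Delta>v / \<Delta>x)"

definition eta4 :: "complex \<Rightarrow> complex \<Rightarrow> real \<Rightarrow> real \<Rightarrow> int \<Rightarrow> complex" where
  "eta4 z r \<Delta>x \<Delta>v m =
    complex_of_real (- 3 * of_int m + sqrt 3) * lambda1 z r * complex_of_real (\<Delta>v / \<Delta>x)"

(* The multiset E lists the eigenvalues of A, each repeated according to its
   algebraic multiplicity. *)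
definition eigenvalues_with_multiplicity :: "complex mat \<Rightarrow> complex multiset \<Rightarrow> bool" where
  "eigenvalues_with_multiplicity A E \<longleftrightarrow>
    spectrum A = set_mset E \<and> (\<forall>z. count E z = Polynomial.order z (char_poly A))"

end

theory Submission
  imports Defs
begin

text \<open>
  The four unknowns of a cell are the tensor product of two values in \<open>x\<close> and two values in \<open>v\<close>,
  and the scheme treats the two directions separately. Accordingly, with
  \<open>w = exp (- \<i> k \<Delta>x)\<close>, the amplification matrix is a Kronecker product \<open>A \<otimes> V\<close> of the
  \<open>2 \<times> 2\<close> matrix
  \<open>A = 1/8 [[7 + 5 w, 3 - 15 w], [- 11 - w, 9 + 3 w]]\<close>, which is the symbol of the upwind
  discretisation of \<open>\<Delta>x/2 \<partial>\<^sub>x\<close>, and \<open>V = \<Delta>v/\<Delta>x [[- m - 7/12, 1/12], [- 1/12, - m + 7/12]]\<close>,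
  which is multiplication by \<open>- 2 v / \<Delta>x\<close> followed by projection onto the polynomials of
  degree at most one in \<open>v\<close>. The eigenvalues of a Kronecker
  product are the products of the eigenvalues of its factors. With \<open>z = w - 1\<close>, the matrix \<open>A\<close> has
  trace \<open>3 + z\<close> and determinant \<open>- 3 z / 2\<close>, hence the eigenvalues
  \<open>(3 + z \<plusminus> r) / 2\<close> with \<open>r\<^sup>2 = (3 + z)\<^sup>2 + 6 z = 9 + 12 z + z\<^sup>2\<close>; these are \<open>3 \<lambda>\<^sub>1\<close> and
  \<open>3 \<lambda>\<^sub>2\<close>. The eigenvalues of \<open>V\<close> are \<open>\<Delta>v/\<Delta>x (- 3 m \<plusminus> \<surd>3) / 3\<close>.

  Multiplicities are obtained by working with characteristic polynomials throughout. The
  lemma \<open>char_poly_kronecker_2\<close> factors the characteristic polynomial of \<open>A \<otimes> V\<close> through the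
  block determinant formula for commuting blocks. It serves twice: for \<open>A \<otimes> V\<close> itself, and for
  the factor \<open>V = V \<otimes> 1\<close>, where it splits the remaining quadratic polynomials.
\<close>

section \<open>Linear factorisations of the characteristic polynomial\<close>

lemma order_linear_factor: "Polynomial.order z [:- a, 1:] = (if z = a then 1 else 0)"
  for a z :: "'a :: idom"
  by (cases "z = a") (simp_all add: order_linear_power[of _ _ 1, simplified] order_0I)

lemma order_prod_linear_factors:
  fixes E :: "'a :: idom multiset"
  shows "Polynomial.order z (\<Prod>a\<in>#E. [:- a, 1:]) = count E z"
proof (induction E)
  case empty
  then show ?case by (simp add: order_0I)
next
  case (add a E)
  have "(\<Prod>a\<in>#E. [:- a, 1:]) \<noteq> 0"
    by (auto simp: prod_mset_zero_iff)
  then have "[:- a, 1:] * (\<Prod>a\<in>#E. [:- a, 1:]) \<noteq> 0"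
    by (metis no_zero_divisors pCons_eq_0_iff one_neq_zero)
  then show ?case
    using add by (simp add: order_mult order_linear_factor del: mult_pCons_left)
qed

lemma eigenvalues_with_multiplicityI:
  assumes A: "A \<in> carrier_mat n n"
    and cp: "char_poly A = (\<Prod>a\<in>#E. [:- a, 1:])"
  shows "eigenvalues_with_multiplicity A E"
proof -
  have "z \<in> spectrum A \<longleftrightarrow> z \<in># E" for z
  proof -
    have "z \<in> spectrum A \<longleftrightarrow> poly (char_poly A) z = 0"
      by (simp add: spectrum_def eigenvalue_root_char_poly[OF A])
    also have "\<dots> \<longleftrightarrow> z \<in># E"
      unfolding cp by (induction E) auto
    finally show ?thesis .
  qed
  then show ?thesis
    by (auto simp: eigenvalues_with_multiplicity_def cp order_prod_linear_factors)
qed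

section \<open>Kronecker products with a two by two matrix\<close>

text \<open>The matrices \<open>p 1 + q W\<close> multiply like polynomials in \<open>W\<close>; in particular they commute.\<close>

lemma mult_linear_in_mat:
  fixes W :: "'a :: comm_ring_1 mat"
  assumes W: "W \<in> carrier_mat n n"
  shows "(p \<cdot>\<^sub>m 1\<^sub>m n + q \<cdot>\<^sub>m W) * (s \<cdot>\<^sub>m 1\<^sub>m n + t \<cdot>\<^sub>m W)
    = (p * s) \<cdot>\<^sub>m 1\<^sub>m n + (p * t + q * s) \<cdot>\<^sub>m W + (q * t) \<cdot>\<^sub>m (W * W)"
proof -
  have "(p \<cdot>\<^sub>m 1\<^sub>m n + q \<cdot>\<^sub>m W) * (s \<cdot>\<^sub>m 1\<^sub>m n + t \<cdot>\<^sub>m W)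
    = p \<cdot>\<^sub>m (s \<cdot>\<^sub>m 1\<^sub>m n + t \<cdot>\<^sub>m W) + q \<cdot>\<^sub>m (s \<cdot>\<^sub>m W + t \<cdot>\<^sub>m (W * W))"
    using W
    by (simp add: add_mult_distrib_mat[of _ n n _ _ n] mult_smult_assoc_mat[of _ n n _ n])
      (simp add: mult_add_distrib_mat[of _ n n _ n] mult_smult_distrib[of _ n n _ n])
  also have "\<dots> = (p * s) \<cdot>\<^sub>m 1\<^sub>m n + (p * t + q * s) \<cdot>\<^sub>m W + (q * t) \<cdot>\<^sub>m (W * W)"
    using W by (intro eq_matI) (auto simp: algebra_simps)
  finally show ?thesis .
qed

text \<open>
  The block matrix is the Kronecker product of \<open>[[a, b], [c, d]]\<close> and \<open>V\<close>. The blocks of its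
  characteristic matrix are polynomials in \<open>V\<close>, so its determinant is that of
  \<open>X\<^sup>2 - (a + d) X V + (a d - b c) V\<^sup>2 = (X - \<mu> V) (X - \<nu> V)\<close>. The hypotheses say that
  \<open>\<mu>\<close> and \<open>\<nu>\<close> are the eigenvalues of \<open>[[a, b], [c, d]]\<close>.
\<close>

lemma char_poly_kronecker_2:
  fixes V :: "'a :: idom mat"
  assumes V: "V \<in> carrier_mat n n"
    and tr: "\<mu> + \<nu> = a + d" and dt: "\<mu> * \<nu> = a * d - b * c"
  shows "char_poly (four_block_mat (a \<cdot>\<^sub>m V) (b \<cdot>\<^sub>m V) (c \<cdot>\<^sub>m V) (d \<cdot>\<^sub>m V))
    = char_poly (\<mu> \<cdot>\<^sub>m V) * char_poly (\<nu> \<cdot>\<^sub>m V)"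
proof -
  define W where "W = map_mat (\<lambda>x. [:x:]) V"
  define L where "L p e = p \<cdot>\<^sub>m 1\<^sub>m n + [:- e:] \<cdot>\<^sub>m W" for p :: "'a poly" and e
  define X :: "'a poly" where "X = [:0, 1:]"
  have W: "W \<in> carrier_mat n n" using V by (simp add: W_def)
  have L: "L p e \<in> carrier_mat n n" for p e using W by (simp add: L_def)
  have L_mult: "L p e * L q f
      = (p * q) \<cdot>\<^sub>m 1\<^sub>m n + (p * [:- f:] + [:- e:] * q) \<cdot>\<^sub>m W + ([:- e:] * [:- f:]) \<cdot>\<^sub>m (W * W)"
    for p q e f
    unfolding L_def by (rule mult_linear_in_mat[OF W])
  have cpm: "char_poly_matrix (e \<cdot>\<^sub>m V) = L X e" for e
    using V by (intro eq_matI) (auto simp: char_poly_matrix_def L_def W_def X_def)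
  have "char_poly_matrix (four_block_mat (a \<cdot>\<^sub>m V) (b \<cdot>\<^sub>m V) (c \<cdot>\<^sub>m V) (d \<cdot>\<^sub>m V))
      = four_block_mat (L X a) (L 0 b) (L 0 c) (L X d)"
    using V by (intro eq_matI) (auto simp: char_poly_matrix_def L_def W_def X_def)
  then have "char_poly (four_block_mat (a \<cdot>\<^sub>m V) (b \<cdot>\<^sub>m V) (c \<cdot>\<^sub>m V) (d \<cdot>\<^sub>m V))
      = det (four_block_mat (L X a) (L 0 b) (L 0 c) (L X d))"
    by (simp add: char_poly_def)
  also have "\<dots> = det (L X a * L X d - L 0 b * L 0 c)"
    by (rule det_four_block_mat[OF L L L L]) (simp add: L_mult algebra_simps)
  also have "L X a * L X d - L 0 b * L 0 c = L X \<mu> * L X \<nu>"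
  proof -
    have tr': "[:\<mu>:] + [:\<nu>:] = [:a:] + [:d:]" using tr by simp
    have dt': "[:\<mu>:] * [:\<nu>:] = [:a:] * [:d:] - [:b:] * [:c:]"
      using dt by (simp add: mult.commute)
    define W2 where "W2 = W * W"
    have W2: "W2 \<in> carrier_mat n n" using W by (simp add: W2_def)
    have neg: "[:- e:] = - [:e:]" for e :: 'a by simp
    have expand: "(X * X) * i + (X * - f + - e * X) * x + - e * - f * y
        - ((0 * 0) * i + (0 * - h + - g * 0) * x + - g * - h * y)
      = X * X * i - (e + f) * (X * x) + (e * f - g * h) * y" for e f g h i x y
      by (simp add: algebra_simps)
    have *: "(X * X) * i + (X * [:- d:] + [:- a:] * X) * x + [:- a:] * [:- d:] * y
        - ((0 * 0) * i + (0 * [:- c:] + [:- b:] * 0) * x + [:- b:] * [:- c:] * y)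
      = (X * X) * i + (X * [:- \<nu>:] + [:- \<mu>:] * X) * x + [:- \<mu>:] * [:- \<nu>:] * y" for i x y
      using expand[of i "[:d:]" "[:a:]" x y "[:c:]" "[:b:]"] expand[of i "[:\<nu>:]" "[:\<mu>:]" x y 0 0]
      unfolding neg tr'[symmetric] dt'[symmetric]
      by (simp del: mult_pCons_left mult_pCons_right)
    show ?thesis
      unfolding L_mult W2_def[symmetric]
      by (rule eq_matI) (use W W2 * in \<open>simp_all del: mult_pCons_left mult_pCons_right\<close>)
  qed
  also have "det (L X \<mu> * L X \<nu>) = char_poly (\<mu> \<cdot>\<^sub>m V) * char_poly (\<nu> \<cdot>\<^sub>m V)"
    by (simp add: det_mult[OF L L] char_poly_def cpm)
  finally show ?thesis .
qed

lemma char_poly_scalar_1: "char_poly (a \<cdot>\<^sub>m 1\<^sub>m 1) = [:- a, 1:]" for a :: "'a :: idom"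
  by (subst char_poly_upper_triangular[of _ 1]) (auto simp: diag_mat_def)

abbreviation mat_2 :: "'a \<Rightarrow> 'a \<Rightarrow> 'a \<Rightarrow> 'a \<Rightarrow> 'a mat" where
  "mat_2 a b c d \<equiv> mat_of_rows_list 2 [[a, b], [c, d]]"

text \<open>A two by two matrix is its own Kronecker product with the one by one identity.\<close>

lemma char_poly_smult_mat_2:
  fixes a :: "'a :: idom"
  assumes tr: "\<mu> + \<nu> = a + d" and dt: "\<mu> * \<nu> = a * d - b * c"
  shows "char_poly (e \<cdot>\<^sub>m mat_2 a b c d) = [:- (e * \<mu>), 1:] * [:- (e * \<nu>), 1:]"
proof -
  have "e \<cdot>\<^sub>m mat_2 a b c d = four_block_mat ((e * a) \<cdot>\<^sub>m 1\<^sub>m 1) ((e * b) \<cdot>\<^sub>m 1\<^sub>m 1)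
      ((e * c) \<cdot>\<^sub>m 1\<^sub>m 1) ((e * d) \<cdot>\<^sub>m 1\<^sub>m 1)"
    by (rule eq_matI) (auto simp: mat_of_rows_list_def less_2_cases_iff)
  moreover have "e * \<mu> + e * \<nu> = e * a + e * d"
    using tr by (simp flip: distrib_left)
  moreover have "e * \<mu> * (e * \<nu>) = e * a * (e * d) - e * b * (e * c)"
  proof -
    have "e * \<mu> * (e * \<nu>) = e * e * (\<mu> * \<nu>)"
      by (simp add: ac_simps)
    then show ?thesis
      by (simp add: dt algebra_simps)
  qed
  ultimately show ?thesis
    using char_poly_kronecker_2[of "1\<^sub>m 1" 1 "e * \<mu>" "e * \<nu>" "e * a" "e * d" "e * b" "e * c"]
    by (simp only: char_poly_scalar_1 one_carrier_mat)
qed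

section \<open>The amplification matrix\<close>

definition V_mat :: "complex \<Rightarrow> int \<Rightarrow> complex mat" where
  "V_mat q m = mat_2 (q * (- of_int m - 7/12)) (q / 12) (- (q / 12)) (q * (- of_int m + 7/12))"

lemma V_mat_carrier: "V_mat q m \<in> carrier_mat 2 2"
  by (rule carrier_matI) (simp_all add: V_mat_def mat_of_rows_list_def)

lemma amplification_matrix_kronecker:
  fixes k \<Delta>x \<Delta>v :: real and m :: int
  defines "w \<equiv> exp (- \<i> * complex_of_real (k * \<Delta>x))"
    and "V \<equiv> V_mat (complex_of_real (\<Delta>v / \<Delta>x)) m"
  shows "amplification_matrix k \<Delta>x \<Delta>v m = four_block_mat
    (((7 + 5 * w) / 8) \<cdot>\<^sub>m V) (((3 - 15 * w) / 8) \<cdot>\<^sub>m V)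
    (((- 11 - w) / 8) \<cdot>\<^sub>m V) (((9 + 3 * w) / 8) \<cdot>\<^sub>m V)"
proof -
  define q where "q = complex_of_real (\<Delta>v / \<Delta>x)"
  show ?thesis
    unfolding amplification_matrix_def V_def V_mat_def w_def[symmetric] q_def[symmetric]
      S_mat_def T_mat_def
  proof (rule eq_matI, goal_cases)
    case (1 i j)
    then have "i < 4" "j < 4"
      by (simp_all add: mat_of_rows_list_def)
    then have "i = 0 \<or> i = 1 \<or> i = 2 \<or> i = 3" "j = 0 \<or> j = 1 \<or> j = 2 \<or> j = 3"
      by linarith+
    then show ?case
      by (elim disjE; simp add: mat_of_rows_list_def numeral_eq_Suc)
        (simp_all add: algebra_simps add_divide_distrib diff_divide_distrib)
  qed (simp_all add: mat_of_rows_list_def)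
qed

text \<open>
  The trace and determinant of \<open>V\<close> are \<open>- 2 q m\<close> and \<open>q\<^sup>2 (m\<^sup>2 - 1/3)\<close>, so its eigenvalues are
  \<open>q (- m \<plusminus> \<surd>3 / 3)\<close>. The scaling \<open>3 l\<close> is the form of the eigenvalues \<open>3 \<lambda>\<^sub>1\<close>, \<open>3 \<lambda>\<^sub>2\<close>
  of the \<open>x\<close>-factor.
\<close>

lemma char_poly_smult_V_mat:
  "char_poly ((3 * l) \<cdot>\<^sub>m V_mat q m)
    = [:- (complex_of_real (- 3 * of_int m - sqrt 3) * l * q), 1:]
      * [:- (complex_of_real (- 3 * of_int m + sqrt 3) * l * q), 1:]"
proof -
  define s where "s = complex_of_real (sqrt 3)"
  have s: "s * s = 3"
    unfolding s_def by (simp flip: of_real_mult)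
  define \<mu> where "\<mu> = q * (- 3 * of_int m - s) / 3"
  define \<nu> where "\<nu> = q * (- 3 * of_int m + s) / 3"
  have "\<mu> + \<nu> = q * (- of_int m - 7/12) + q * (- of_int m + 7/12)"
    by (simp add: \<mu>_def \<nu>_def field_simps)
  moreover have "\<mu> * \<nu> = q * (- of_int m - 7/12) * (q * (- of_int m + 7/12))
      - q / 12 * (- (q / 12))"
  proof -
    have "\<mu> * \<nu> = q * q * (9 * of_int m * of_int m - s * s) / 9"
      by (simp add: \<mu>_def \<nu>_def field_simps)
    also have "\<dots> = q * (- of_int m - 7/12) * (q * (- of_int m + 7/12)) - q / 12 * (- (q / 12))"
      unfolding s by (simp add: field_simps)
    finally show ?thesis .
  qed
  ultimately have "char_poly ((3 * l) \<cdot>\<^sub>m V_mat q m)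
      = [:- (3 * l * \<mu>), 1:] * [:- (3 * l * \<nu>), 1:]"
    unfolding V_mat_def by (rule char_poly_smult_mat_2)
  moreover have "3 * l * \<mu> = complex_of_real (- 3 * of_int m - sqrt 3) * l * q"
    "3 * l * \<nu> = complex_of_real (- 3 * of_int m + sqrt 3) * l * q"
    by (simp_all add: \<mu>_def \<nu>_def s_def)
  ultimately show ?thesis by simp
qed

theorem mainTheorem2:
  fixes k \<Delta>x \<Delta>v :: real and m :: int and r :: complex
  assumes "k > 0" and "\<Delta>x > 0" and "\<Delta>v > 0"
    and "m > 0" and "odd m"
    and "r\<^sup>2 = 9 + 12 * i_hat k \<Delta>x + (i_hat k \<Delta>x)\<^sup>2"
  shows "eigenvalues_with_multiplicity (amplification_matrix k \<Delta>x \<Delta>v m)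
    {# eta1 (i_hat k \<Delta>x) r \<Delta>x \<Delta>v m, eta2 (i_hat k \<Delta>x) r \<Delta>x \<Delta>v m,
       eta3 (i_hat k \<Delta>x) r \<Delta>x \<Delta>v m, eta4 (i_hat k \<Delta>x) r \<Delta>x \<Delta>v m #}"
proof (rule eigenvalues_with_multiplicityI)
  show "amplification_matrix k \<Delta>x \<Delta>v m \<in> carrier_mat 4 4"
    by (rule carrier_matI)
      (simp_all add: amplification_matrix_def S_mat_def T_mat_def mat_of_rows_list_def)
next
  define w where "w = exp (- \<i> * complex_of_real (k * \<Delta>x))"
  define z where "z = i_hat k \<Delta>x"
  have w: "w = z + 1"
    by (simp add: w_def z_def i_hat_def)
  have r: "r * r = 9 + 12 * z + z * z"
    using assms(6) by (simp add: z_def power2_eq_square)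
  have "3 * lambda2 z r + 3 * lambda1 z r = (7 + 5 * w) / 8 + (9 + 3 * w) / 8"
    by (simp add: lambda1_def lambda2_def w field_simps)
  moreover have "3 * lambda2 z r * (3 * lambda1 z r)
      = (7 + 5 * w) / 8 * ((9 + 3 * w) / 8) - (3 - 15 * w) / 8 * ((- 11 - w) / 8)"
  proof -
    have "3 * lambda2 z r * (3 * lambda1 z r) = ((3 + z) * (3 + z) - r * r) / 4"
      by (simp add: lambda1_def lambda2_def field_simps)
    then show ?thesis
      unfolding r w by (simp add: field_simps)
  qed
  ultimately have "char_poly (amplification_matrix k \<Delta>x \<Delta>v m)
      = char_poly ((3 * lambda2 z r) \<cdot>\<^sub>m V_mat (complex_of_real (\<Delta>v / \<Delta>x)) m)
        * char_poly ((3 * lambda1 z r) \<cdot>\<^sub>m V_mat (complex_of_real (\<Delta>v / \<Delta>x)) m)"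
    unfolding amplification_matrix_kronecker w_def[symmetric]
    by (rule char_poly_kronecker_2[OF V_mat_carrier])
  also have "\<dots> = [:- eta1 z r \<Delta>x \<Delta>v m, 1:] * [:- eta2 z r \<Delta>x \<Delta>v m, 1:]
      * ([:- eta3 z r \<Delta>x \<Delta>v m, 1:] * [:- eta4 z r \<Delta>x \<Delta>v m, 1:])"
    unfolding char_poly_smult_V_mat eta1_def eta2_def eta3_def eta4_def ..
  finally show "char_poly (amplification_matrix k \<Delta>x \<Delta>v m)
      = (\<Prod>a\<in>#{# eta1 (i_hat k \<Delta>x) r \<Delta>x \<Delta>v m, eta2 (i_hat k \<Delta>x) r \<Delta>x \<Delta>v m,
       eta3 (i_hat k \<Delta>x) r \<Delta>x \<Delta>v m, eta4 (i_hat k \<Delta>x) r \<Delta>x \<Delta>v m #}. [:- a, 1:])"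
    by (simp only: z_def image_mset_add_mset image_mset_empty prod_mset.add_mset
        prod_mset.empty mult_1_right mult.assoc)
qed

end
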